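(* Let $K$ be an algebraically closed field of characteristic $0$, let $d\ge 1$, and let $P_1,\ldots,P_n$ be $n\leq d+1$ general points of $\mathbf{P}^d$ ($n\geq 1$). Let $I\subset K[\mathbf{P}^d]$ be the radical ideal of $\{P_1,\ldots,P_n\}$ and let $M\subset K[\mathbf{P}^d]$ be the ideal generated by the variables. Then for all $r\geq1$: (a) $I^{(rd)}\subseteq M^{r(d-1)}I^r$; and (b) $I^{(rd-(d-1))}\subseteq M^{(r-1)(d-1)}I^r$.
   Context: A statement holds for $n$ general points of $\mathbf{P}^d$ if there is a nonempty Zariski open subset $U\subseteq(\mathbf{P}^d)^n$ such that it holds for all $(P_1,\ldots,P_n)\in U$. For a finite set of distinct points with radical ideal $I=\bigcap_i I(P_i)$, where $I(P_i)$ is the ideal generated by all forms vanishing at $P_i$, the $m$-th symbolic power is $I^{(m)}=\bigcap_i I(P_i)^m$. For any ideal $J$, $J^0$ is the whole ring. *)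

theory Defs
  imports "HOL-Library.Poly_Mapping" "HOL-Library.Cardinality" "HOL-Computational_Algebra.Polynomial"
begin

section \<open>Polynomials in finitely many variables\<close>

text \<open>
  Monomials are exponent vectors. With a finite index type \<open>'v\<close> of \<open>d + 1\<close> elements,
  the type \<open>('v, 'k) mpoly\<close> is the polynomial ring in \<open>d + 1\<close> variables over \<open>'k\<close>, that is,
  the homogeneous coordinate ring of projective \<open>d\<close>-space.
\<close>

type_synonym ('v, 'k) mpoly = "('v \<Rightarrow>\<^sub>0 nat) \<Rightarrow>\<^sub>0 'k"

definition mvar :: "'v \<Rightarrow> ('v, 'k::comm_ring_1) mpoly" where
  "mvar i = Poly_Mapping.single (Poly_Mapping.single i 1) 1"

definition mpoly_eval :: "('v::finite, 'k::comm_ring_1) mpoly \<Rightarrow> ('v \<Rightarrow> 'k) \<Rightarrow> 'k" where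
  "mpoly_eval f x =
     (\<Sum>m\<in>Poly_Mapping.keys f. Poly_Mapping.lookup f m * (\<Prod>i\<in>UNIV. x i ^ Poly_Mapping.lookup m i))"

definition is_form :: "('v::finite, 'k::comm_ring_1) mpoly \<Rightarrow> bool" where
  "is_form f \<longleftrightarrow> (\<exists>e. \<forall>m\<in>Poly_Mapping.keys f. (\<Sum>i\<in>UNIV. Poly_Mapping.lookup m i) = e)"


section \<open>Ideals of a commutative ring\<close>

text \<open>Ideals of \<open>'a\<close> are the submodules of \<open>'a\<close> regarded as a module over itself.\<close>

global_interpretation self_module: module "(*) :: 'a::comm_ring_1 \<Rightarrow> 'a \<Rightarrow> 'a"
  by unfold_locales (simp_all add: algebra_simps)

definition ideal_gen :: "'a::comm_ring_1 set \<Rightarrow> 'a set" where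
  "ideal_gen S = module.span (*) S"

definition ideal_mult :: "'a::comm_ring_1 set \<Rightarrow> 'a set \<Rightarrow> 'a set" where
  "ideal_mult I J = ideal_gen {a * b | a b. a \<in> I \<and> b \<in> J}"

primrec ideal_pow :: "'a::comm_ring_1 set \<Rightarrow> nat \<Rightarrow> 'a set" where
  "ideal_pow I 0 = UNIV"
| "ideal_pow I (Suc m) = ideal_mult I (ideal_pow I m)"

definition irrelevant_ideal :: "('v, 'k::comm_ring_1) mpoly set" where
  "irrelevant_ideal = ideal_gen (range mvar)"


section \<open>Projective space and ideals of points\<close>

definition proportional :: "('v \<Rightarrow> 'k::field) \<Rightarrow> ('v \<Rightarrow> 'k) \<Rightarrow> bool" where
  "proportional x y \<longleftrightarrow> (\<exists>i. x i \<noteq> 0) \<and> (\<exists>c. c \<noteq> 0 \<and> y = (\<lambda>i. c * x i))"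

lemma part_equivp_proportional: "part_equivp (proportional :: ('v \<Rightarrow> 'k::field) \<Rightarrow> _)"
proof (rule part_equivpI)
  show "\<exists>x :: 'v \<Rightarrow> 'k. proportional x x"
    by (rule exI[of _ "\<lambda>_. 1"]) (auto simp: proportional_def intro!: exI[of _ 1])
  show "symp (proportional :: ('v \<Rightarrow> 'k) \<Rightarrow> _)"
  proof (rule sympI)
    fix x y :: "'v \<Rightarrow> 'k"
    assume "proportional x y"
    then obtain i c where "x i \<noteq> 0" "c \<noteq> 0" "y = (\<lambda>i. c * x i)"
      by (auto simp: proportional_def)
    then have "y i \<noteq> 0" "inverse c \<noteq> 0" "x = (\<lambda>i. inverse c * y i)"
      by (auto simp flip: mult.assoc)
    then show "proportional y x"
      unfolding proportional_def by blast
  qed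
  show "transp (proportional :: ('v \<Rightarrow> 'k) \<Rightarrow> _)"
  proof (rule transpI)
    fix x y z :: "'v \<Rightarrow> 'k"
    assume "proportional x y" "proportional y z"
    then obtain b c where "\<exists>i. x i \<noteq> 0" "b \<noteq> 0" "c \<noteq> 0"
      and "y = (\<lambda>i. b * x i)" "z = (\<lambda>i. c * y i)"
      unfolding proportional_def by blast
    then have "\<exists>i. x i \<noteq> 0" "c * b \<noteq> 0" "z = (\<lambda>i. (c * b) * x i)"
      by (simp_all only: mult.assoc mult_eq_0_iff) auto
    then show "proportional x z"
      unfolding proportional_def by blast
  qed
qed

text \<open>The relation is partial because the zero vector does not represent a point.\<close>

quotient_type (overloaded) ('v, 'k) proj_point = "'v \<Rightarrow> 'k::field" / partial: proportional
  by (rule part_equivp_proportional)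

text \<open>\<open>has_coords P x\<close> means that \<open>x\<close> is a vector of homogeneous coordinates of \<open>P\<close>.\<close>

lift_definition has_coords :: "('v, 'k::field) proj_point \<Rightarrow> ('v \<Rightarrow> 'k) \<Rightarrow> bool" is proportional
  using part_equivp_symp[OF part_equivp_proportional] part_equivp_transp[OF part_equivp_proportional]
  by blast

definition vanishes_at :: "('v::finite, 'k::field) mpoly \<Rightarrow> ('v, 'k) proj_point \<Rightarrow> bool" where
  "vanishes_at f P \<longleftrightarrow> (\<forall>x. has_coords P x \<longrightarrow> mpoly_eval f x = 0)"

definition point_ideal :: "('v::finite, 'k::field) proj_point \<Rightarrow> ('v, 'k) mpoly set" where
  "point_ideal P = ideal_gen {f. is_form f \<and> vanishes_at f P}"

definition radical_ideal :: "('v::finite, 'k::field) proj_point set \<Rightarrow> ('v, 'k) mpoly set" where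
  "radical_ideal S = (\<Inter>P\<in>S. point_ideal P)"

text \<open>The \<open>m\<close>-th symbolic power of the ideal \<open>radical_ideal S\<close>, for a finite set of points \<open>S\<close>.\<close>

definition symbolic_power :: "('v::finite, 'k::field) proj_point set \<Rightarrow> nat \<Rightarrow> ('v, 'k) mpoly set" where
  "symbolic_power S m = (\<Inter>P\<in>S. ideal_pow (point_ideal P) m)"


section \<open>General points\<close>

text \<open>
  A tuple of points is a function from a finite index type \<open>'n\<close>. Closed subsets of the product of
  \<open>CARD('n)\<close> copies of projective space are the common zero loci of sets of multihomogeneous
  polynomials, whose variables are indexed by a factor and a coordinate. This is the Zariski
  topology on the product variety, not the product topology.
\<close>

definition is_multiform :: "('n::finite \<times> 'v::finite, 'k::comm_ring_1) mpoly \<Rightarrow> bool" where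
  "is_multiform g \<longleftrightarrow>
     (\<exists>e. \<forall>m\<in>Poly_Mapping.keys g. \<forall>j. (\<Sum>i\<in>UNIV. Poly_Mapping.lookup m (j, i)) = e j)"

definition multi_vanishes_at ::
    "('n::finite \<times> 'v::finite, 'k::field) mpoly \<Rightarrow> ('n \<Rightarrow> ('v, 'k) proj_point) \<Rightarrow> bool" where
  "multi_vanishes_at g P \<longleftrightarrow>
     (\<forall>x. (\<forall>j. has_coords (P j) (x j)) \<longrightarrow> mpoly_eval g (\<lambda>(j, i). x j i) = 0)"

definition zariski_closed :: "('n::finite \<Rightarrow> ('v::finite, 'k::field) proj_point) set \<Rightarrow> bool" where
  "zariski_closed Z \<longleftrightarrow>
     (\<exists>G. (\<forall>g\<in>G. is_multiform g) \<and> Z = {P. \<forall>g\<in>G. multi_vanishes_at g P})"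

definition zariski_open :: "('n::finite \<Rightarrow> ('v::finite, 'k::field) proj_point) set \<Rightarrow> bool" where
  "zariski_open U \<longleftrightarrow> zariski_closed (- U)"

definition for_general_points ::
    "(('n::finite \<Rightarrow> ('v::finite, 'k::field) proj_point) \<Rightarrow> bool) \<Rightarrow> bool" where
  "for_general_points \<Phi> \<longleftrightarrow> (\<exists>U. zariski_open U \<and> U \<noteq> {} \<and> (\<forall>P\<in>U. \<Phi> P))"

end

theory Submission
  imports Defs "HOL-Analysis.Determinants"
begin

text \<open>
  General points are linearly independent, so in suitable linear coordinates they are coordinate
  points. In these coordinates every monomial \<open>a\<close> of an element of the symbolic power satisfies
  \<open>deg a - a\<^sub>j \<ge> m\<close> for each point \<open>j\<close>. The radical ideal contains the variables vanishing at all
  points and the products of two distinct variables; pairing off the variables of \<open>a\<close> accordingly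
  yields \<open>r\<close> such factors, and what is left still has the degree required of the factor in \<open>M\<close>.
  The latter follows by summing the inequalities over the points and using \<open>n \<le> d + 1\<close>.
\<close>

section \<open>Ideals\<close>

lemma ideal_gen_base: "a \<in> S \<Longrightarrow> a \<in> ideal_gen S"
  unfolding ideal_gen_def by (rule self_module.span_base)

lemma ideal_gen_minimal:
  assumes "\<And>a. a \<in> S \<Longrightarrow> a \<in> T" and "module.subspace (*) T"
  shows "ideal_gen S \<subseteq> T"
  unfolding ideal_gen_def using assms by (intro self_module.span_minimal) auto

lemma subspace_ideal_mult: "module.subspace (*) (ideal_mult I J)"
  unfolding ideal_mult_def ideal_gen_def by (rule self_module.subspace_span)

lemma ideal_mult_memI: "a \<in> I \<Longrightarrow> b \<in> J \<Longrightarrow> a * b \<in> ideal_mult I J"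
  unfolding ideal_mult_def by (rule ideal_gen_base) blast

lemma ideal_mult_subsetI:
  assumes "\<And>a b. a \<in> I \<Longrightarrow> b \<in> J \<Longrightarrow> a * b \<in> T" and "module.subspace (*) T"
  shows "ideal_mult I J \<subseteq> T"
  unfolding ideal_mult_def using assms by (intro ideal_gen_minimal) auto

section \<open>Monomials in products of powers of ideals\<close>

text \<open>Degree bookkeeping for splitting one variable off a monomial. Subtraction on naturals is
  truncated, so positivity comes as a separate claim.\<close>

lemma sum_fun_upd_pred:
  fixes a :: "'v::finite \<Rightarrow> nat"
  assumes "a i > 0"
  shows "sum (a(i := a i - 1)) S = (if i \<in> S then sum a S - 1 else sum a S)"
    and "i \<in> S \<Longrightarrow> sum a S > 0"
proof -
  have eq: "sum (a(i := a i - 1)) (S - {i}) = sum a (S - {i})"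
    by (rule sum.cong) auto
  have rem: "sum b S = b i + sum b (S - {i})" if "i \<in> S" for b :: "'v \<Rightarrow> nat"
    by (rule sum.remove[OF _ that]) simp
  show "i \<in> S \<Longrightarrow> sum a S > 0"
    using rem[of a] assms by linarith
  show "sum (a(i := a i - 1)) S = (if i \<in> S then sum a S - 1 else sum a S)"
  proof (cases "i \<in> S")
    case True
    have "sum (a(i := a i - 1)) S = (a i - 1) + sum a (S - {i})"
      unfolding rem[OF True, of "a(i := a i - 1)"] eq by simp
    then have "sum (a(i := a i - 1)) S = sum a S - 1"
      using rem[OF True, of a] assms by linarith
    then show ?thesis using True by (simp only: if_True)
  next
    case False
    then have "S - {i} = S" by blast
    then show ?thesis using eq False by (simp only: if_False)
  qed
qed

lemma prod_power_fun_upd_pred: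
  fixes L :: "'v::finite \<Rightarrow> 'a::comm_monoid_mult" and a :: "'v \<Rightarrow> nat"
  assumes "a i > 0"
  shows "(\<Prod>k\<in>UNIV. L k ^ a k) = L i * (\<Prod>k\<in>UNIV. L k ^ (a(i := a i - 1)) k)"
proof -
  have "(\<Prod>k\<in>UNIV. L k ^ a k) = L i ^ a i * (\<Prod>k\<in>UNIV - {i}. L k ^ a k)"
    by (rule prod.remove) auto
  also have "L i ^ a i = L i * L i ^ (a i - 1)"
    using assms by (cases "a i") auto
  also have "(\<Prod>k\<in>UNIV - {i}. L k ^ a k) = (\<Prod>k\<in>UNIV - {i}. L k ^ (a(i := a i - 1)) k)"
    by (rule prod.cong) auto
  also have "L i * L i ^ (a i - 1) * \<dots> = L i * (L i ^ (a(i := a i - 1)) i * \<dots>)"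
    by (simp add: mult.assoc)
  also have "L i ^ (a(i := a i - 1)) i * (\<Prod>k\<in>UNIV - {i}. L k ^ (a(i := a i - 1)) k)
      = (\<Prod>k\<in>UNIV. L k ^ (a(i := a i - 1)) k)"
    by (rule prod.remove[symmetric]) auto
  finally show ?thesis .
qed

text \<open>Peel off one variable per power of \<open>M\<close>; the surplus is absorbed because
  \<open>ideal_pow M 0\<close> is the whole ring.\<close>

lemma monomial_in_ideal_pow:
  fixes L :: "'v::finite \<Rightarrow> 'a::comm_ring_1"
  assumes "\<And>i. L i \<in> M" and "t \<le> sum a UNIV"
  shows "(\<Prod>k\<in>UNIV. L k ^ a k) \<in> ideal_pow M t"
  using assms(2)
proof (induction t arbitrary: a)
  case 0
  then show ?case by simp
next
  case (Suc t)
  then have "sum a UNIV \<noteq> 0" by linarith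
  then obtain i where i: "a i > 0" by auto
  have "t \<le> sum (a(i := a i - 1)) UNIV"
    using Suc.prems unfolding sum_fun_upd_pred(1)[of a, OF i] by simp
  from Suc.IH[OF this] show ?case
    unfolding prod_power_fun_upd_pred[of a i L, OF i] ideal_pow.simps
    by (rule ideal_mult_memI[OF assms(1)])
qed

text \<open>Greedy factorisation: split off a variable outside \<open>N\<close> while there is one; otherwise split off
  the variable of largest exponent together with any other one.\<close>

lemma monomial_factorisation:
  fixes L :: "'v::finite \<Rightarrow> 'a::comm_ring_1"
  assumes M: "\<And>i. L i \<in> M"
    and I1: "\<And>i. i \<notin> N \<Longrightarrow> L i \<in> I"
    and I2: "\<And>i j. i \<noteq> j \<Longrightarrow> L i * L j \<in> I"
    and "t + r \<le> sum a UNIV"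
    and "t + 2 * r \<le> sum a UNIV + sum a (- N)"
    and "\<And>j. j \<in> N \<Longrightarrow> r \<le> sum a (- {j})"
  shows "\<exists>u v. u \<in> ideal_pow M t \<and> v \<in> ideal_pow I r \<and> (\<Prod>k\<in>UNIV. L k ^ a k) = u * v"
  \<comment> \<open>These bounds are the invariants. With D the degree and z the degree outside
    \<open>N\<close>, a factor in \<open>I\<close> costs one variable outside \<open>N\<close> or a
    pair of distinct ones, so leaving degree t requires t + r <= D and t + 2r <= D + z. The third
    bound keeps any variable from being too dominant to pair off.\<close>
  using assms(4-6)
proof (induction r arbitrary: a)
  case 0
  then have "(\<Prod>k\<in>UNIV. L k ^ a k) \<in> ideal_pow M t"
    by (intro monomial_in_ideal_pow M) simp
  then show ?case by (intro exI[of _ "\<Prod>k\<in>UNIV. L k ^ a k"] exI[of _ 1]) simp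
next
  case (Suc r)
  have split1: "sum b UNIV = b j + sum b (- {j})" for b :: "'v \<Rightarrow> nat" and j
    unfolding Compl_eq_Diff_UNIV by (rule sum.remove) auto
  show ?case
  proof (cases "\<exists>i. i \<notin> N \<and> a i > 0")
    case True
    then obtain i where i: "i \<notin> N" "a i > 0" by blast
    let ?a = "a(i := a i - 1)"
    have b: "sum ?a S = (if i \<in> S then sum a S - 1 else sum a S)" for S
      by (rule sum_fun_upd_pred(1)[of a, OF i(2)])
    have "\<exists>u v. u \<in> ideal_pow M t \<and> v \<in> ideal_pow I r \<and> (\<Prod>k\<in>UNIV. L k ^ ?a k) = u * v"
    proof (rule Suc.IH)
      \<comment> \<open>Here D, z and r each drop by one; z > 0 makes the truncated subtraction
        exact.\<close>
      show "t + r \<le> sum ?a UNIV" "t + 2 * r \<le> sum ?a UNIV + sum ?a (- N)"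
        using Suc.prems(1,2) sum_fun_upd_pred(2)[of a i "- N"] i
        unfolding b[of UNIV] b[of "- N"] by simp_all
      show "r \<le> sum ?a (- {j})" if "j \<in> N" for j
      proof -
        have "sum a (- {j}) \<le> sum ?a (- {j}) + 1"
          unfolding b by (cases "i \<in> - {j}", simp_all only: if_True if_False)
        then show ?thesis using Suc.prems(3)[OF that] by linarith
      qed
    qed
    then obtain u v where uv: "u \<in> ideal_pow M t" "v \<in> ideal_pow I r"
      "(\<Prod>k\<in>UNIV. L k ^ ?a k) = u * v" by blast
    have "L i * v \<in> ideal_pow I (Suc r)"
      using I1[OF i(1)] uv(2) by (simp add: ideal_mult_memI)
    moreover have "(\<Prod>k\<in>UNIV. L k ^ a k) = u * (L i * v)"
      unfolding prod_power_fun_upd_pred[of a i L, OF i(2)] uv(3) by (rule mult.left_commute)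
    ultimately show ?thesis using uv(1) by blast
  next
    case False
    then have z: "sum a (- N) = 0" by (auto intro!: sum.neutral)
    have "sum a UNIV \<noteq> 0" using Suc.prems(1) by linarith
    \<comment> \<open>Reducing a largest exponent is what preserves the third invariant.\<close>
    obtain j where j: "\<And>k. a k \<le> a j"
    proof -
      have "Max (range a) \<in> range a" by (rule Max_in) auto
      then obtain j where "a j = Max (range a)" by (metis imageE)
      then have "a k \<le> a j" for k by simp
      then show ?thesis using that by blast
    qed
    have aj: "a j > 0"
    proof (rule gr0I)
      assume "a j = 0"
      then have "a k = 0" for k using j[of k] by simp
      then show False using \<open>sum a UNIV \<noteq> 0\<close> by simp
    qed
    then have "j \<in> N" using False by blast
    then have "sum a (- {j}) \<noteq> 0" using Suc.prems(3)[of j] by linarith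
    then obtain k where k: "k \<noteq> j" "a k > 0" by auto
    let ?b = "a(j := a j - 1)"
    let ?c = "?b(k := ?b k - 1)"
    have bk: "?b k > 0" using k by simp
    have b: "sum ?b S = (if j \<in> S then sum a S - 1 else sum a S)" for S
      by (rule sum_fun_upd_pred(1)[of a, OF aj])
    have c: "sum ?c S = (if k \<in> S then sum ?b S - 1 else sum ?b S)" for S
      by (rule sum_fun_upd_pred(1)[of ?b, OF bk])
    have "\<exists>u v. u \<in> ideal_pow M t \<and> v \<in> ideal_pow I r \<and> (\<Prod>k\<in>UNIV. L k ^ ?c k) = u * v"
    proof (rule Suc.IH)
      \<comment> \<open>Since z = 0, the second invariant reads t + 2(r + 1) <= D, so both bounds
        survive the loss of two variables.\<close>
      show "t + r \<le> sum ?c UNIV" "t + 2 * r \<le> sum ?c UNIV + sum ?c (- N)"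
        using Suc.prems(2) z unfolding c b by simp_all
      show "r \<le> sum ?c (- {l})" if l: "l \<in> N" for l
      \<comment> \<open>If \<open>l\<close> belongs to the pair, the degree away from
        \<open>l\<close> drops only by one, as does the required bound.\<close>
      proof (cases "l = j \<or> l = k")
        case True
        then have "sum ?c (- {l}) = sum a (- {l}) - 1"
          unfolding c b using True k(1) by auto
        then show ?thesis using Suc.prems(3)[OF l] by linarith
      next
        case False
        \<comment> \<open>Let E be the degree away from \<open>l\<close>. Maximality of
          \<open>a j\<close> and \<open>a k > 0\<close> give a_l + 1 <= E, while a_l + E >= 2r + 2.
          Hence 2E >= 2r + 3, so E >= r + 2, which leaves room for the loss of two.\<close>
        have "sum a {l, j, k} \<le> sum a UNIV" by (rule sum_mono2) auto
        then have "a l + a j + a k \<le> a l + sum a (- {l})"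
          using False k(1) split1[of a l] by simp
        then have "a l + 1 \<le> sum a (- {l})" using j[of l] k(2) by simp
        moreover have "2 * Suc r \<le> a l + sum a (- {l})"
          using Suc.prems(2) unfolding z split1[of a l] by simp
        ultimately have "r + 2 \<le> sum a (- {l})" by simp
        moreover have "sum a (- {l}) \<le> sum ?c (- {l}) + 2"
          unfolding c b
          by (cases "k \<in> - {l}"; cases "j \<in> - {l}", simp_all only: if_True if_False)
        ultimately show ?thesis by linarith
      qed
    qed
    then obtain u v where uv: "u \<in> ideal_pow M t" "v \<in> ideal_pow I r"
      "(\<Prod>k\<in>UNIV. L k ^ ?c k) = u * v" by blast
    have "(L j * L k) * v \<in> ideal_pow I (Suc r)"
      unfolding ideal_pow.simps using k(1) uv(2) by (intro ideal_mult_memI I2) auto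
    moreover have "(\<Prod>i\<in>UNIV. L i ^ a i) = u * ((L j * L k) * v)"
      unfolding prod_power_fun_upd_pred[of a j L, OF aj] prod_power_fun_upd_pred[of ?b k L, OF bk] uv(3)
      by (simp only: mult_ac)
    ultimately show ?thesis using uv(1) by blast
  qed
qed

section \<open>Degree inequalities\<close>

text \<open>Add the inequalities over \<open>N\<close>: the p + 1 right-hand sides omit each
  variable of \<open>N\<close> exactly once, so they total (p + 1)D - (D - z) = pD + z, where D is
  the degree and z the degree outside \<open>N\<close>. Adding \<open>sum a N\<close> to both sides
  avoids the subtraction.\<close>

lemma sum_Compl_singletons:
  fixes a :: "'v::finite \<Rightarrow> nat"
  assumes "\<And>j. j \<in> N \<Longrightarrow> m \<le> sum a (- {j})" and "card N = Suc p"
  shows "Suc p * m \<le> p * sum a UNIV + sum a (- N)"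
proof -
  have split: "sum a UNIV = sum a S + sum a (- S)" for S
    using sum.union_disjoint[of S "- S" a] by (simp add: Compl_partition)
  have "Suc p * m + sum a N \<le> (\<Sum>j\<in>N. sum a (- {j})) + sum a N"
    using sum_mono[of N "\<lambda>_. m" "\<lambda>j. sum a (- {j})"] assms by simp
  also have "\<dots> = (\<Sum>j\<in>N. sum a UNIV)"
    unfolding sum.distrib[symmetric] using split[of "{j}" for j]
    by (intro sum.cong) (auto simp: add.commute)
  also have "\<dots> = sum a UNIV + p * sum a UNIV"
    by (simp add: assms(2))
  finally show ?thesis using split[of N] by simp
qed

text \<open>\<open>Suc p\<close> counts the points, \<open>D\<close> is the degree of a monomial and
  \<open>z\<close> its degree in the variables attached to no point. As p <= d, p(rd + r) <= (p +
  1)rd <= pD + z <= p(D + z), and a positive p cancels. For p = 0, use r <= rd and that both D and z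
  are at least rd.\<close>

lemma degree_bound_a:
  fixes d p r D z :: nat
  assumes "Suc p * (r * d) \<le> p * D + z" and "r * d \<le> D" and "z \<le> D" and "d \<ge> 1" and "p \<le> d"
  shows "r * (d - 1) + r \<le> D" and "r * (d - 1) + 2 * r \<le> D + z"
proof -
  have rd: "r * d = r * (d - 1) + r" using \<open>d \<ge> 1\<close> by (cases d) auto
  then show "r * (d - 1) + r \<le> D" using assms by simp
  show "r * (d - 1) + 2 * r \<le> D + z"
  proof (cases p)
    case 0
    then show ?thesis using assms rd mult_le_mono2[OF \<open>d \<ge> 1\<close>, of r] by simp
  next
    case (Suc q)
    have "p * (r * d + r) \<le> p * (r * d) + r * d"
      using \<open>p \<le> d\<close> by (simp add: algebra_simps)
    also have "\<dots> \<le> p * D + z" using assms(1) by simp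
    also have "\<dots> \<le> p * (D + z)" using Suc by simp
    finally have "r * d + r \<le> D + z" using Suc by (metis mult_le_cancel1 zero_less_Suc)
    then show ?thesis using rd by simp
  qed
qed

text \<open>Here r = s + 1. The same chain of estimates is now strict because sp < sd + 1, and
  strictness supplies the last unit of the second bound.\<close>

lemma degree_bound_b:
  fixes d p s D z :: nat
  assumes "Suc p * (s * d + 1) \<le> p * D + z" and "s * d + 1 \<le> D" and "z \<le> D" and "d \<ge> 1" and "p \<le> d"
  shows "s * (d - 1) + Suc s \<le> D" and "s * (d - 1) + 2 * Suc s \<le> D + z"
proof -
  have sd: "s * d = s * (d - 1) + s" using \<open>d \<ge> 1\<close> by (cases d) auto
  then show "s * (d - 1) + Suc s \<le> D" using assms by simp
  show "s * (d - 1) + 2 * Suc s \<le> D + z"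
  proof (cases p)
    case 0
    then show ?thesis using assms sd mult_le_mono2[OF \<open>d \<ge> 1\<close>, of s] by simp
  next
    case (Suc q)
    have "p * (s * d + 1 + s) = p * (s * d + 1) + s * p"
      by (simp add: algebra_simps)
    also have "\<dots> < p * (s * d + 1) + (s * d + 1)"
      using mult_le_mono2[OF \<open>p \<le> d\<close>, of s] by linarith
    also have "\<dots> \<le> p * D + z" using assms(1) by simp
    also have "\<dots> \<le> p * (D + z)" using Suc by simp
    finally have "s * d + 1 + s < D + z" by (metis mult_less_cancel1)
    then show ?thesis using sd by simp
  qed
qed

section \<open>Substitution into polynomials\<close>

lemma mpoly_monomial_sum:
  fixes f :: "('v, 'k::comm_ring_1) mpoly"
  shows "f = (\<Sum>m\<in>Poly_Mapping.keys f. Poly_Mapping.single m (Poly_Mapping.lookup f m))"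
  by (rule poly_mapping_eqI)
    (simp add: lookup_sum lookup_single when_def in_keys_iff)

lemma mpoly_induct [case_names zero single add]:
  fixes f :: "('v, 'k::comm_ring_1) mpoly"
  assumes "P 0" and "\<And>m c. P (Poly_Mapping.single m c)" and "\<And>f g. P f \<Longrightarrow> P g \<Longrightarrow> P (f + g)"
  shows "P f"
proof -
  have "P (\<Sum>m\<in>S. Poly_Mapping.single m (Poly_Mapping.lookup f m))" if "finite S" for S
    using that by (induction S rule: finite_induct) (auto intro: assms)
  from this[of "Poly_Mapping.keys f"] show ?thesis
    using mpoly_monomial_sum[of f] by simp
qed

section \<open>Ring homomorphisms\<close>

text \<open>A bare predicate on functions, shared by the embedding of constants, evaluation and
  changes of coordinates.\<close>

definition ring_hom :: "('a::comm_ring_1 \<Rightarrow> 'b::comm_ring_1) \<Rightarrow> bool" where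
  "ring_hom h \<longleftrightarrow> h 1 = 1 \<and> (\<forall>x y. h (x + y) = h x + h y) \<and> (\<forall>x y. h (x * y) = h x * h y)"

lemma ring_homD:
  assumes "ring_hom h"
  shows "h 1 = 1" and "h (x + y) = h x + h y" and "h (x * y) = h x * h y" and "h 0 = 0"
    and "h (- x) = - h x" and "h (x ^ k) = h x ^ k"
proof -
  show 1: "h 1 = 1" "h (x + y) = h x + h y" "h (x * y) = h x * h y" for x y
    using assms by (auto simp: ring_hom_def)
  have "h 0 + h 0 = h 0" using 1(2)[of 0 0] by simp
  then show 0: "h 0 = 0" by simp
  have "h (- x) + h x = 0" using 1(2)[of "- x" x] 0 by simp
  then show "h (- x) = - h x" by (simp add: eq_neg_iff_add_eq_0)
  show "h (x ^ k) = h x ^ k" by (induction k) (simp_all add: 1)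
qed

lemma ring_hom_sum: "ring_hom h \<Longrightarrow> h (sum f S) = (\<Sum>x\<in>S. h (f x))"
  by (induction S rule: infinite_finite_induct) (simp_all add: ring_homD)

lemma ring_hom_prod: "ring_hom h \<Longrightarrow> h (prod f S) = (\<Prod>x\<in>S. h (f x))"
  by (induction S rule: infinite_finite_induct) (simp_all add: ring_homD)

text \<open>Handles the signs of permutations in the Leibniz formula.\<close>

lemma ring_hom_of_int: "ring_hom h \<Longrightarrow> h (of_int k) = of_int k"
proof (induction k rule: int_induct[where k = 0])
  case base
  then show ?case by (simp add: ring_homD)
next
  case (step1 i)
  then show ?case by (simp add: ring_homD)
next
  case (step2 i)
  then show ?case using ring_homD(2)[of h "of_int i" "- 1"] by (simp add: ring_homD)
qed

text \<open>A determinant is a polynomial in its entries with integer coefficients.\<close>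

lemma ring_hom_det:
  assumes "ring_hom h"
  shows "h (det A) = det (\<chi> i j. h (A $ i $ j))"
  unfolding det_def
  by (simp add: ring_hom_sum[OF assms] ring_homD(3)[OF assms] ring_hom_prod[OF assms]
      ring_hom_of_int[OF assms])

definition mconst :: "'k \<Rightarrow> ('v, 'k::comm_ring_1) mpoly" where
  "mconst c = Poly_Mapping.single 0 c"

lemma ring_hom_mconst: "ring_hom mconst"
  by (simp add: ring_hom_def mconst_def single_add mult_single)

lemma ring_hom_id: "ring_hom (\<lambda>x. x)"
  by (simp add: ring_hom_def)

lemma ring_hom_comp: "ring_hom g \<Longrightarrow> ring_hom h \<Longrightarrow> ring_hom (g \<circ> h)"
  by (simp add: ring_hom_def)

text \<open>The coefficient map \<open>h\<close> is separate so that evaluation (\<open>h\<close>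
  the identity) and change of coordinates (\<open>h = mconst\<close>) are one operation.\<close>

definition msubst ::
    "('k::comm_ring_1 \<Rightarrow> 'a::comm_ring_1) \<Rightarrow> ('v::finite \<Rightarrow> 'a) \<Rightarrow> ('v, 'k) mpoly \<Rightarrow> 'a" where
  "msubst h L f = (\<Sum>m\<in>Poly_Mapping.keys f.
     h (Poly_Mapping.lookup f m) * (\<Prod>i\<in>UNIV. L i ^ Poly_Mapping.lookup m i))"

lemma mpoly_eval_conv_msubst: "mpoly_eval f x = msubst (\<lambda>x. x) x f"
  by (simp add: mpoly_eval_def msubst_def)

lemma msubst_single:
  assumes "ring_hom h"
  shows "msubst h L (Poly_Mapping.single m c) = h c * (\<Prod>i\<in>UNIV. L i ^ Poly_Mapping.lookup m i)"
  by (cases "c = 0") (simp_all add: msubst_def ring_homD[OF assms])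

lemma msubst_add:
  assumes "ring_hom h"
  shows "msubst h L (f + g) = msubst h L f + msubst h L g"
  unfolding msubst_def
  by (rule setsum_keys_plus_distrib) (simp_all add: ring_homD[OF assms] algebra_simps)

text \<open>Biadditivity reduces the claim to two single terms, whose exponents add.\<close>

lemma msubst_mult:
  fixes f g :: "('v::finite, 'k::comm_ring_1) mpoly"
  assumes "ring_hom h"
  shows "msubst h L (f * g) = msubst h L f * msubst h L g"
proof (induction f rule: mpoly_induct)
  case zero
  then show ?case by (simp add: msubst_def)
next
  case (add f1 f2)
  then show ?case by (simp add: distrib_right msubst_add[OF assms])
next
  case (single m c)
  show ?case
  proof (induction g rule: mpoly_induct)
    case zero
    then show ?case by (simp add: msubst_def)
  next
    case (add g1 g2)
    then show ?case by (simp add: distrib_left msubst_add[OF assms])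
  next
    case (single n b)
    have "(\<Prod>i\<in>UNIV. L i ^ Poly_Mapping.lookup (m + n) i) =
        (\<Prod>i\<in>UNIV. L i ^ Poly_Mapping.lookup m i) * (\<Prod>i\<in>UNIV. L i ^ Poly_Mapping.lookup n i)"
      by (simp add: lookup_add power_add prod.distrib)
    then show ?case
      by (simp only: mult_single msubst_single[OF assms] ring_homD(3)[OF assms] mult_ac)
  qed
qed

lemma ring_hom_msubst:
  assumes "ring_hom h"
  shows "ring_hom (msubst h L)"
proof -
  have "msubst h L 1 = 1"
    using msubst_single[OF assms, of L 0 1] by (simp add: ring_homD[OF assms])
  then show ?thesis
    by (simp add: ring_hom_def msubst_add[OF assms] msubst_mult[OF assms])
qed

lemma msubst_mconst: "ring_hom h \<Longrightarrow> msubst h L (mconst c) = h c"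
  by (simp add: mconst_def msubst_single)

lemma msubst_mvar:
  assumes "ring_hom h"
  shows "msubst h L (mvar i) = L i"
proof -
  have "(\<Prod>k\<in>UNIV. L k ^ Poly_Mapping.lookup (Poly_Mapping.single i (1::nat)) k)
      = (\<Prod>k\<in>UNIV. if k = i then L k else 1)"
    by (rule prod.cong) (auto simp: lookup_single when_def)
  then show ?thesis
    by (simp add: mvar_def msubst_single[OF assms] ring_homD[OF assms])
qed

lemma prod_mvar_power:
  fixes m :: "'v::finite \<Rightarrow>\<^sub>0 nat"
  shows "(\<Prod>i\<in>UNIV. (mvar i :: ('v, 'k::comm_ring_1) mpoly) ^ Poly_Mapping.lookup m i)
    = Poly_Mapping.single m 1"
proof -
  have pow: "(mvar i :: ('v, 'k) mpoly) ^ e = Poly_Mapping.single (Poly_Mapping.single i e) 1"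
    for i e
    by (induction e) (simp_all add: mvar_def mult_single flip: single_add)
  have "(\<Prod>i\<in>S. Poly_Mapping.single (Poly_Mapping.single i (Poly_Mapping.lookup m i)) (1::'k))
      = Poly_Mapping.single (\<Sum>i\<in>S. Poly_Mapping.single i (Poly_Mapping.lookup m i)) 1" for S
    by (induction S rule: infinite_finite_induct) (simp_all add: mult_single)
  moreover have "(\<Sum>i\<in>UNIV. Poly_Mapping.single i (Poly_Mapping.lookup m i)) = m"
    by (rule poly_mapping_eqI) (simp add: lookup_sum lookup_single when_def)
  ultimately show ?thesis by (simp add: pow)
qed

text \<open>The uniqueness half of the universal property: homomorphisms can be compared on
  constants and variables alone.\<close>

lemma ring_hom_conv_msubst:
  fixes \<phi> :: "('v::finite, 'k::comm_ring_1) mpoly \<Rightarrow> 'a::comm_ring_1"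
  assumes "ring_hom \<phi>"
  shows "\<phi> f = msubst (\<lambda>c. \<phi> (mconst c)) (\<lambda>i. \<phi> (mvar i)) f"
proof -
  have monomial: "\<phi> (Poly_Mapping.single m c) =
      \<phi> (mconst c) * (\<Prod>i\<in>UNIV. \<phi> (mvar i) ^ Poly_Mapping.lookup m i)" for m c
  proof -
    have "Poly_Mapping.single m c = mconst c * (\<Prod>i\<in>UNIV. mvar i ^ Poly_Mapping.lookup m i)"
      unfolding prod_mvar_power by (simp add: mconst_def mult_single)
    then show ?thesis
      by (simp only: ring_homD(3,6)[OF assms] ring_hom_prod[OF assms])
  qed
  have "\<phi> f = \<phi> (\<Sum>m\<in>Poly_Mapping.keys f. Poly_Mapping.single m (Poly_Mapping.lookup f m))"
    using mpoly_monomial_sum[of f] by simp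
  also have "\<dots> = msubst (\<lambda>c. \<phi> (mconst c)) (\<lambda>i. \<phi> (mvar i)) f"
    unfolding msubst_def ring_hom_sum[OF assms]
    by (simp only: monomial)
  finally show ?thesis .
qed

section \<open>Homogeneity\<close>

text \<open>The weight is a parameter because forms use the total degree and multiforms the degree
  in each factor of the product.\<close>

definition homogeneous :: "(('v \<Rightarrow>\<^sub>0 nat) \<Rightarrow> nat) \<Rightarrow> nat \<Rightarrow> ('v, 'k::comm_ring_1) mpoly \<Rightarrow> bool" where
  "homogeneous w e f \<longleftrightarrow> (\<forall>m\<in>Poly_Mapping.keys f. w m = e)"

definition additive_weight :: "(('v \<Rightarrow>\<^sub>0 nat) \<Rightarrow> nat) \<Rightarrow> bool" where
  "additive_weight w \<longleftrightarrow> w 0 = 0 \<and> (\<forall>m n. w (m + n) = w m + w n)"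

lemma homogeneous_0: "homogeneous w e 0"
  by (simp add: homogeneous_def)

lemma homogeneous_add: "homogeneous w e f \<Longrightarrow> homogeneous w e g \<Longrightarrow> homogeneous w e (f + g)"
  using keys_add[of f g] by (auto simp: homogeneous_def)

lemma homogeneous_sum: "(\<And>x. x \<in> S \<Longrightarrow> homogeneous w e (f x)) \<Longrightarrow> homogeneous w e (sum f S)"
  by (induction S rule: infinite_finite_induct) (auto intro: homogeneous_0 homogeneous_add)

lemma homogeneous_mult:
  "additive_weight w \<Longrightarrow> homogeneous w e f \<Longrightarrow> homogeneous w e' g \<Longrightarrow> homogeneous w (e + e') (f * g)"
  using keys_mult[of f g] by (fastforce simp: homogeneous_def additive_weight_def)

lemma homogeneous_mconst: "additive_weight w \<Longrightarrow> homogeneous w 0 (mconst c)"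
  by (auto simp: homogeneous_def mconst_def additive_weight_def)

lemma homogeneous_one: "additive_weight w \<Longrightarrow> homogeneous w 0 1"
  by (auto simp: homogeneous_def additive_weight_def)

lemma homogeneous_prod:
  "additive_weight w \<Longrightarrow> (\<And>x. x \<in> S \<Longrightarrow> homogeneous w (e x) (f x)) \<Longrightarrow>
    homogeneous w (sum e S) (prod f S)"
  by (induction S rule: infinite_finite_induct) (auto intro: homogeneous_one homogeneous_mult)

lemma homogeneous_power:
  assumes "additive_weight w" and "homogeneous w e f"
  shows "homogeneous w (k * e) (f ^ k)"
  by (induction k) (auto intro: homogeneous_one homogeneous_mult assms)

lemma homogeneous_mvar: "homogeneous w (w (Poly_Mapping.single i 1)) (mvar i)"
  by (auto simp: homogeneous_def mvar_def)

lemma homogeneous_mconst_mult: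
  "additive_weight w \<Longrightarrow> homogeneous w e f \<Longrightarrow> homogeneous w e (mconst c * f)"
  using homogeneous_mult[OF _ homogeneous_mconst] by fastforce

abbreviation total_degree :: "('v::finite \<Rightarrow>\<^sub>0 nat) \<Rightarrow> nat" where
  "total_degree m \<equiv> \<Sum>i\<in>UNIV. Poly_Mapping.lookup m i"

lemma additive_weight_sum: "additive_weight (\<lambda>m. \<Sum>i\<in>S. Poly_Mapping.lookup m (p i))"
  by (simp add: additive_weight_def lookup_add sum.distrib)

lemma additive_weight_total_degree: "additive_weight total_degree"
  by (rule additive_weight_sum)

lemma total_degree_single: "total_degree (Poly_Mapping.single i 1) = 1"
  by (simp add: lookup_single when_def)

lemma is_form_conv_homogeneous: "is_form f \<longleftrightarrow> (\<exists>e. homogeneous total_degree e f)"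
  by (simp add: is_form_def homogeneous_def)

lemma is_multiform_conv_homogeneous:
  "is_multiform g \<longleftrightarrow>
    (\<exists>e. \<forall>j. homogeneous (\<lambda>m. \<Sum>i\<in>UNIV. Poly_Mapping.lookup m (j, i)) (e j) g)"
  unfolding is_multiform_def homogeneous_def by blast

section \<open>Linear forms and linear substitutions\<close>

definition linear_form :: "('v::finite \<Rightarrow> 'k) \<Rightarrow> ('v, 'k::comm_ring_1) mpoly" where
  "linear_form b = (\<Sum>k\<in>UNIV. mconst (b k) * mvar k)"

lemma homogeneous_linear_form: "homogeneous total_degree 1 (linear_form b)"
  unfolding linear_form_def
  by (rule homogeneous_sum, rule homogeneous_mconst_mult[OF additive_weight_sum])
    (metis homogeneous_mvar total_degree_single)

lemma msubst_linear_form: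
  "ring_hom h \<Longrightarrow> msubst h L (linear_form b) = (\<Sum>k\<in>UNIV. h (b k) * L k)"
  by (simp add: linear_form_def ring_hom_sum[OF ring_hom_msubst] ring_homD(3)[OF ring_hom_msubst]
      msubst_mconst msubst_mvar)

lemma mpoly_eval_linear_form: "mpoly_eval (linear_form b) x = (\<Sum>k\<in>UNIV. b k * x k)"
  by (simp add: mpoly_eval_conv_msubst msubst_linear_form[OF ring_hom_id])

lemma linear_form_unit: "linear_form (\<lambda>k. if k = i then 1 else 0) = mvar i"
proof -
  have "linear_form (\<lambda>k. if k = i then 1 else 0) = (\<Sum>k\<in>UNIV. if k = i then mvar k else 0)"
    unfolding linear_form_def
    by (rule sum.cong) (auto simp: ring_homD[OF ring_hom_mconst])
  then show ?thesis by simp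
qed

lemma linear_form_in_irrelevant_ideal: "linear_form b \<in> irrelevant_ideal"
  unfolding linear_form_def irrelevant_ideal_def ideal_gen_def
  by (intro self_module.span_sum self_module.span_scale self_module.span_base) simp

text \<open>Every variable is replaced by something homogeneous of degree one, so each monomial
  keeps its degree.\<close>

lemma homogeneous_msubst_linear_forms:
  assumes "homogeneous total_degree e f"
  shows "homogeneous total_degree e (msubst mconst (\<lambda>k. linear_form (B k)) f)"
  unfolding msubst_def
proof (rule homogeneous_sum, rule homogeneous_mconst_mult[OF additive_weight_total_degree])
  fix m assume "m \<in> Poly_Mapping.keys f"
  then have e: "(\<Sum>i\<in>UNIV. Poly_Mapping.lookup m i * 1) = e"
    using assms by (simp add: homogeneous_def)
  have "homogeneous total_degree (\<Sum>i\<in>UNIV. Poly_Mapping.lookup m i * 1)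
      (\<Prod>i\<in>UNIV. linear_form (B i) ^ Poly_Mapping.lookup m i)"
    by (rule homogeneous_prod[OF additive_weight_total_degree])
      (rule homogeneous_power[OF additive_weight_total_degree homogeneous_linear_form])
  then show "homogeneous total_degree e (\<Prod>i\<in>UNIV. linear_form (B i) ^ Poly_Mapping.lookup m i)"
    unfolding e .
qed

section \<open>Ideals of points in linear coordinates\<close>

text \<open>This is the \<open>m\<close>-th power of the ideal of the \<open>s\<close>-th coordinate
  point, which the other variables generate, described by exponents alone.\<close>

definition off_degree_ge :: "'v \<Rightarrow> nat \<Rightarrow> ('v::finite, 'k::comm_ring_1) mpoly set" where
  "off_degree_ge s m = {f. \<forall>a\<in>Poly_Mapping.keys f. m \<le> sum (Poly_Mapping.lookup a) (- {s})}"

lemma off_degree_ge_mult: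
  "f \<in> off_degree_ge s m \<Longrightarrow> g \<in> off_degree_ge s m' \<Longrightarrow> f * g \<in> off_degree_ge s (m + m')"
  using keys_mult[of f g]
  by (fastforce simp: off_degree_ge_def lookup_add sum.distrib intro: add_mono)

lemma off_degree_ge_0: "f \<in> off_degree_ge s 0"
  by (simp add: off_degree_ge_def)

lemma subspace_off_degree_ge: "module.subspace (*) (off_degree_ge s m)"
proof (rule self_module.subspaceI)
  show "0 \<in> off_degree_ge s m" by (simp add: off_degree_ge_def)
  show "x + y \<in> off_degree_ge s m" if "x \<in> off_degree_ge s m" "y \<in> off_degree_ge s m" for x y
    using that keys_add[of x y] by (auto simp: off_degree_ge_def)
  \<comment> \<open>Every multiplier lies in \<open>off_degree_ge s 0\<close>, and the bounds
    add.\<close>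
  show "c * x \<in> off_degree_ge s m" if "x \<in> off_degree_ge s m" for c x
    using off_degree_ge_mult[OF off_degree_ge_0 that] by simp
qed

lemma subspace_vimage_ring_hom:
  assumes "ring_hom \<phi>" and "module.subspace (*) T"
  shows "module.subspace (*) (\<phi> -` T)"
  using assms(2) unfolding self_module.subspace_def
  by (auto simp: ring_homD[OF assms(1)])

text \<open>Bounds add in products, and preimages of ideals under ring homomorphisms are ideals, so
  the bound for \<open>J\<close> propagates to its powers.\<close>

lemma ideal_pow_vimage_off_degree_ge:
  assumes "ring_hom \<phi>" and "J \<subseteq> \<phi> -` off_degree_ge s 1"
  shows "ideal_pow J m \<subseteq> \<phi> -` off_degree_ge s m"
proof (induction m)
  case 0
  then show ?case by (auto simp: off_degree_ge_0)
next
  case (Suc m)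
  show ?case unfolding ideal_pow.simps
  proof (rule ideal_mult_subsetI)
    fix a b assume "a \<in> J" "b \<in> ideal_pow J m"
    then have "\<phi> a * \<phi> b \<in> off_degree_ge s (1 + m)"
      using assms(2) Suc by (intro off_degree_ge_mult) auto
    then show "a * b \<in> \<phi> -` off_degree_ge s (Suc m)"
      by (simp add: ring_homD[OF assms(1)])
  qed (rule subspace_vimage_ring_hom[OF assms(1) subspace_off_degree_ge])
qed

text \<open>A form of degree \<open>e\<close> takes at the \<open>s\<close>-th unit vector the value of its coefficient at the
  \<open>e\<close>-th power of the \<open>s\<close>-th variable.\<close>

lemma form_vanishing_at_unit_vector:
  fixes g :: "('v::finite, 'k::comm_ring_1) mpoly"
  assumes hom: "homogeneous total_degree e g"
    and eval: "mpoly_eval g (\<lambda>i. if i = s then 1 else 0) = 0"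
  shows "g \<in> off_degree_ge s 1"
proof (rule ccontr)
  assume "g \<notin> off_degree_ge s 1"
  then obtain a where a: "a \<in> Poly_Mapping.keys g" "sum (Poly_Mapping.lookup a) (- {s}) = 0"
    by (auto simp: off_degree_ge_def not_le)
  \<comment> \<open>A monomial of degree \<open>e\<close> free of the other variables can only be
    this pure power, so at most one monomial survives evaluation.\<close>
  have pure: "b = Poly_Mapping.single s e"
    if "b \<in> Poly_Mapping.keys g" "sum (Poly_Mapping.lookup b) (- {s}) = 0" for b
  proof -
    have off: "Poly_Mapping.lookup b i = 0" if "i \<noteq> s" for i
      using \<open>sum (Poly_Mapping.lookup b) (- {s}) = 0\<close> that by simp
    have "Poly_Mapping.lookup b s + sum (Poly_Mapping.lookup b) (UNIV - {s}) = e"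
      using hom that(1) by (subst sum.remove[symmetric]) (auto simp: homogeneous_def)
    then have "Poly_Mapping.lookup b s = e"
      using that(2) by (simp add: Compl_eq_Diff_UNIV)
    then show ?thesis using off
      by (intro poly_mapping_eqI) (auto simp: lookup_single when_def)
  qed
  have "(\<Prod>i\<in>UNIV. (if i = s then 1 else 0 :: 'k) ^ Poly_Mapping.lookup b i) = 0"
    if "b \<in> Poly_Mapping.keys g" "b \<noteq> a" for b
  proof -
    have "sum (Poly_Mapping.lookup b) (- {s}) \<noteq> 0"
    proof
      assume "sum (Poly_Mapping.lookup b) (- {s}) = 0"
      then show False using pure[OF that(1)] pure[OF a] that(2) by simp
    qed
    then obtain i where "i \<in> - {s}" "Poly_Mapping.lookup b i \<noteq> 0"
      by (rule sum.not_neutral_contains_not_neutral)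
    then have "(if i = s then 1 else 0 :: 'k) ^ Poly_Mapping.lookup b i = 0"
      by (simp add: power_0_left)
    then show ?thesis by (intro prod_zero finite bexI[OF _ UNIV_I])
  qed
  then have "mpoly_eval g (\<lambda>i. if i = s then 1 else 0) =
      Poly_Mapping.lookup g a * (\<Prod>i\<in>UNIV. (if i = s then 1 else 0 :: 'k) ^ Poly_Mapping.lookup a i)"
    unfolding mpoly_eval_def using a(1)
    by (subst sum.remove[of _ a]) (auto intro: sum.neutral)
  also have "(\<Prod>i\<in>UNIV. (if i = s then 1 else 0 :: 'k) ^ Poly_Mapping.lookup a i) = 1"
    using a(2) by (intro prod.neutral) auto
  finally show False using eval a(1) by (simp add: in_keys_iff)
qed

section \<open>Points under a change of coordinates\<close>

lemma has_coords_scale: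
  assumes "has_coords P x" and "has_coords P y"
  shows "\<exists>c. y = (\<lambda>i. c * x i)"
proof -
  have "proportional x y"
    using assms
  proof transfer
    fix P x y :: "'a \<Rightarrow> 'b"
    assume "proportional P x" "proportional P y"
    then show "proportional x y"
      by (metis part_equivp_proportional part_equivp_symp part_equivp_transp)
  qed
  then show ?thesis by (auto simp: proportional_def)
qed

text \<open>Vanishing is required on all coordinate vectors of the point; they differ by a scalar,
  which factors out.\<close>

lemma linear_form_in_point_ideal:
  assumes "has_coords P x" and "(\<Sum>k\<in>UNIV. b k * x k) = 0"
  shows "linear_form b \<in> point_ideal P"
  unfolding point_ideal_def
proof (rule ideal_gen_base, intro CollectI conjI)
  show "is_form (linear_form b)"
    unfolding is_form_conv_homogeneous by (rule exI, rule homogeneous_linear_form)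
  show "vanishes_at (linear_form b) P"
    unfolding vanishes_at_def
  proof (intro allI impI)
    fix y assume "has_coords P y"
    then obtain c where y: "y = (\<lambda>i. c * x i)" using has_coords_scale[OF assms(1)] by blast
    have "mpoly_eval (linear_form b) y = c * (\<Sum>k\<in>UNIV. b k * x k)"
      unfolding mpoly_eval_linear_form y sum_distrib_left by (rule sum.cong) (simp_all only: mult_ac)
    then show "mpoly_eval (linear_form b) y = 0" unfolding assms(2) by simp
  qed
qed

lemma subspace_point_ideal: "module.subspace (*) (point_ideal P)"
  unfolding point_ideal_def ideal_gen_def by (rule self_module.subspace_span)

lemma point_ideal_scale: "a \<in> point_ideal P \<Longrightarrow> c * a \<in> point_ideal P"
  using subspace_point_ideal self_module.subspace_scale by blast

text \<open>The substitution is pullback along y -> yA for row vectors y, which sends the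
  \<open>s\<close>-th unit vector to row \<open>s\<close> of \<open>A\<close>. A form vanishing at
  \<open>P\<close> thus pulls back to one vanishing at that unit vector.\<close>

lemma point_ideal_subset_vimage:
  fixes A :: "'k::field ^ 'v ^ 'v::finite"
  assumes "has_coords P (($) (A $ s))"
  shows "point_ideal P \<subseteq>
    msubst mconst (\<lambda>k. linear_form (\<lambda>i. A $ i $ k)) -` off_degree_ge s 1"
    (is "_ \<subseteq> ?\<psi> -` _")
  unfolding point_ideal_def
proof (rule ideal_gen_minimal)
  fix f :: "('v, 'k) mpoly" assume "f \<in> {f. is_form f \<and> vanishes_at f P}"
  then obtain e where f: "homogeneous total_degree e f" "mpoly_eval f (($) (A $ s)) = 0"
    using assms by (auto simp: is_form_conv_homogeneous vanishes_at_def)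
  let ?u = "\<lambda>i. if i = s then 1 else 0 :: 'k"
  have hom: "ring_hom (msubst (\<lambda>x. x) ?u \<circ> ?\<psi>)"
    by (intro ring_hom_comp ring_hom_msubst ring_hom_mconst ring_hom_id)
  have row: "msubst (\<lambda>x. x) ?u (linear_form (\<lambda>i. A $ i $ k)) = A $ s $ k" for k
    unfolding msubst_linear_form[OF ring_hom_id] by (simp add: if_distrib cong: if_cong)
  \<comment> \<open>Both sides are homomorphisms in \<open>f\<close>, so constants and variables
    decide.\<close>
  have "(msubst (\<lambda>x. x) ?u \<circ> ?\<psi>) f = msubst (\<lambda>x. x) (($) (A $ s)) f"
    unfolding ring_hom_conv_msubst[OF hom, of f]
    by (simp only: o_apply msubst_mconst[OF ring_hom_mconst] msubst_mvar[OF ring_hom_mconst]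
        msubst_mconst[OF ring_hom_id] row)
  then have "mpoly_eval (?\<psi> f) ?u = 0"
    using f(2) by (simp add: mpoly_eval_conv_msubst)
  then show "f \<in> ?\<psi> -` off_degree_ge s 1"
    using form_vanishing_at_unit_vector[OF homogeneous_msubst_linear_forms[OF f(1)]] by simp
qed (intro subspace_vimage_ring_hom ring_hom_msubst ring_hom_mconst subspace_off_degree_ge)

text \<open>The composite is a ring homomorphism fixing constants, and it sends the k-th variable to
  the linear form given by column k of \<open>B ** A\<close>.\<close>

lemma msubst_linear_forms_inverse:
  fixes A B :: "'k::field ^ 'v ^ 'v::finite"
  assumes "B ** A = mat 1"
  shows "msubst mconst (\<lambda>i. linear_form (\<lambda>k. B $ k $ i))
    (msubst mconst (\<lambda>k. linear_form (\<lambda>i. A $ i $ k)) f) = f"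
proof -
  let ?\<phi> = "msubst mconst (\<lambda>i. linear_form (\<lambda>k. B $ k $ i))"
  let ?\<psi> = "msubst mconst (\<lambda>k. linear_form (\<lambda>i. A $ i $ k))"
  have hom: "ring_hom (?\<phi> \<circ> ?\<psi>)"
    by (rule ring_hom_comp; rule ring_hom_msubst[OF ring_hom_mconst])
  have var: "?\<phi> (?\<psi> (mvar k)) = mvar k" for k
  proof -
    have "?\<phi> (?\<psi> (mvar k)) = (\<Sum>i\<in>UNIV. mconst (A $ i $ k) * (\<Sum>l\<in>UNIV. mconst (B $ l $ i) * mvar l))"
      unfolding msubst_mvar[OF ring_hom_mconst] msubst_linear_form[OF ring_hom_mconst]
      by (simp only: linear_form_def)
    also have "\<dots> = (\<Sum>l\<in>UNIV. \<Sum>i\<in>UNIV. mconst (A $ i $ k) * (mconst (B $ l $ i) * mvar l))"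
      unfolding sum_distrib_left by (rule sum.swap)
    also have "\<dots> = (\<Sum>l\<in>UNIV. mconst ((B ** A) $ l $ k) * mvar l)"
      unfolding matrix_matrix_mult_def vec_lambda_beta ring_hom_sum[OF ring_hom_mconst]
        ring_homD(3)[OF ring_hom_mconst] sum_distrib_right by (simp only: mult_ac)
    also have "\<dots> = linear_form (\<lambda>l. if l = k then 1 else 0)"
      by (simp only: assms mat_def linear_form_def vec_lambda_beta)
    also have "\<dots> = mvar k" by (rule linear_form_unit)
    finally show ?thesis .
  qed
  have "(?\<phi> \<circ> ?\<psi>) f = msubst mconst mvar f"
    unfolding ring_hom_conv_msubst[OF hom, of f]
    by (simp only: o_apply var msubst_mconst[OF ring_hom_mconst])
  also have "msubst mconst mvar f = f"
    by (rule ring_hom_conv_msubst[OF ring_hom_id, symmetric])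
  finally show ?thesis by simp
qed

text \<open>Reduces the containment to the numerical condition \<open>bounds\<close>: membership in
  the symbolic power constrains the exponents of \<open>f\<close> in adapted coordinates, and each
  monomial allowed there factors into the two ideals.\<close>

lemma symbolic_power_subset_independent:
  fixes P :: "'n::finite \<Rightarrow> ('v::finite, 'k::field) proj_point" and A :: "'k ^ 'v ^ 'v"
  assumes "invertible A" and coords: "\<And>j. has_coords (P j) (($) (A $ \<sigma> j))"
    and bounds: "\<And>a :: 'v \<Rightarrow> nat. (\<And>j. m \<le> sum a (- {\<sigma> j})) \<Longrightarrow>
      r \<le> m \<and> t + r \<le> sum a UNIV \<and> t + 2 * r \<le> sum a UNIV + sum a (- range \<sigma>)"
  shows "symbolic_power (range P) m \<subseteq>
    ideal_mult (ideal_pow irrelevant_ideal t) (ideal_pow (radical_ideal (range P)) r)"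
proof
  fix f assume f: "f \<in> symbolic_power (range P) m"
  obtain B where B: "A ** B = mat 1" "B ** A = mat 1"
    using assms(1) by (auto simp: invertible_def)
  \<comment> \<open>The columns of the inverse give the basis dual to the rows of \<open>A\<close>:
    \<open>L i\<close> is 1 on row \<open>i\<close> and 0 on all other rows.\<close>
  define L where "L = (\<lambda>i. linear_form (\<lambda>k. B $ k $ i))"
  define \<psi> where "\<psi> = msubst mconst (\<lambda>k. linear_form (\<lambda>i. A $ i $ k))"
  have L: "L i \<in> point_ideal (P j)" if "i \<noteq> \<sigma> j" for i j
  proof -
    have "(\<Sum>k\<in>UNIV. B $ k $ i * A $ \<sigma> j $ k) = (A ** B) $ \<sigma> j $ i"
      by (simp add: matrix_matrix_mult_def mult_ac)
    also have "\<dots> = 0" using that by (simp add: B mat_def)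
    finally show ?thesis
      unfolding L_def by (intro linear_form_in_point_ideal[OF coords])
  qed
  have I1: "L i \<in> radical_ideal (range P)" if "i \<notin> range \<sigma>" for i
    using that L by (auto simp: radical_ideal_def)
  \<comment> \<open>At each point at least one of two distinct dual forms vanishes.\<close>
  have I2: "L i * L k \<in> radical_ideal (range P)" if "i \<noteq> k" for i k
    unfolding radical_ideal_def
  proof (safe)
    fix j
    show "L i * L k \<in> point_ideal (P j)"
      using L[of i j] L[of k j] that point_ideal_scale[of "L i" "P j" "L k"]
        point_ideal_scale[of "L k" "P j" "L i"] by (cases "i = \<sigma> j") (auto simp: mult.commute)
  qed
  have key: "m \<le> sum (Poly_Mapping.lookup a) (- {\<sigma> j})" if "a \<in> Poly_Mapping.keys (\<psi> f)" for a j
  proof -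
    have "ideal_pow (point_ideal (P j)) m \<subseteq> \<psi> -` off_degree_ge (\<sigma> j) m"
      unfolding \<psi>_def
      by (intro ideal_pow_vimage_off_degree_ge point_ideal_subset_vimage coords ring_hom_msubst
          ring_hom_mconst)
    then have "\<psi> f \<in> off_degree_ge (\<sigma> j) m"
      using f by (auto simp: symbolic_power_def)
    then show ?thesis using that by (auto simp: off_degree_ge_def)
  qed
  let ?Q = "ideal_mult (ideal_pow irrelevant_ideal t) (ideal_pow (radical_ideal (range P)) r)"
  have mono: "(\<Prod>i\<in>UNIV. L i ^ Poly_Mapping.lookup a i) \<in> ?Q" if "a \<in> Poly_Mapping.keys (\<psi> f)" for a
  proof -
    have "\<exists>u v. u \<in> ideal_pow irrelevant_ideal t \<and> v \<in> ideal_pow (radical_ideal (range P)) r \<and>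
        (\<Prod>i\<in>UNIV. L i ^ Poly_Mapping.lookup a i) = u * v"
    proof (rule monomial_factorisation[where N = "range \<sigma>"])
      show "L i \<in> irrelevant_ideal" for i
        unfolding L_def by (rule linear_form_in_irrelevant_ideal)
      show "r \<le> sum (Poly_Mapping.lookup a) (- {j})" if "j \<in> range \<sigma>" for j
        using that bounds[OF key[OF \<open>a \<in> _\<close>]] key[OF \<open>a \<in> _\<close>] order.trans by blast
    qed (use I1 I2 bounds[OF key[OF that]] in auto)
    then show ?thesis by (auto intro: ideal_mult_memI)
  qed
  \<comment> \<open>Substituting \<open>L\<close> into \<open>\<psi> f\<close> recovers
    \<open>f\<close> as a combination of these monomials.\<close>
  have "msubst mconst L (\<psi> f) \<in> ?Q"
    unfolding msubst_def
    by (intro self_module.subspace_sum[OF subspace_ideal_mult]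
        self_module.subspace_scale[OF subspace_ideal_mult] mono)
  then show "f \<in> ?Q"
    unfolding L_def \<psi>_def msubst_linear_forms_inverse[OF B(2)] .
qed

section \<open>Genericity of linear independence\<close>

text \<open>Filling up with unit vectors yields a square matrix, so that a single multihomogeneous
  determinant certifies the linear independence of the points.\<close>

definition coord_matrix :: "('n \<Rightarrow> 'v) \<Rightarrow> ('n \<times> 'v \<Rightarrow> 'a) \<Rightarrow> 'a::comm_ring_1 ^ 'v ^ 'v::finite" where
  "coord_matrix \<sigma> x = (\<chi> i k. if i \<in> range \<sigma> then x (inv \<sigma> i, k) else if i = k then 1 else 0)"

text \<open>Each Leibniz product takes one entry from every row, and the variables of factor
  \<open>j\<close> occur only in row \<open>\<sigma> j\<close>. The degree is therefore one in every
  factor.\<close>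

lemma is_multiform_det_coord_matrix:
  fixes \<sigma> :: "'n::finite \<Rightarrow> 'v::finite"
  assumes "inj \<sigma>"
  shows "is_multiform (det (coord_matrix \<sigma> mvar) :: ('n \<times> 'v, 'k::comm_ring_1) mpoly)"
  unfolding is_multiform_conv_homogeneous
proof (intro exI[of _ "\<lambda>_. 1"] allI)
  fix j :: 'n
  let ?w = "\<lambda>m :: 'n \<times> 'v \<Rightarrow>\<^sub>0 nat. \<Sum>i\<in>UNIV. Poly_Mapping.lookup m (j, i)"
  have w: "additive_weight ?w" by (rule additive_weight_sum)
  have entry: "homogeneous ?w (if i = \<sigma> j then 1 else 0)
      (coord_matrix \<sigma> mvar $ i $ k :: ('n \<times> 'v, 'k) mpoly)" for i k
  proof (cases "i \<in> range \<sigma>")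
    case True
    then obtain j' where j': "i = \<sigma> j'" by blast
    have "?w (Poly_Mapping.single (j', k) 1) = (if j = j' then 1 else 0)"
      by (simp add: lookup_single when_def)
    then show ?thesis
      using homogeneous_mvar[of ?w "(j', k)"] assms
      by (auto simp: coord_matrix_def j' inj_eq)
  next
    case False
    then show ?thesis
      using homogeneous_one[OF w] by (auto simp: coord_matrix_def homogeneous_0)
  qed
  have "homogeneous ?w (\<Sum>i\<in>UNIV. if i = \<sigma> j then 1 else 0)
      (\<Prod>i\<in>UNIV. coord_matrix \<sigma> mvar $ i $ p i :: ('n \<times> 'v, 'k) mpoly)" for p
    by (intro homogeneous_prod[OF w] entry)
  then have "homogeneous ?w 1 (\<Prod>i\<in>UNIV. coord_matrix \<sigma> mvar $ i $ p i :: ('n \<times> 'v, 'k) mpoly)" for p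
    by simp
  \<comment> \<open>Signs are constants, so they do not change the degree.\<close>
  moreover have "of_int k = (mconst (of_int k) :: ('n \<times> 'v, 'k) mpoly)" for k
    by (simp add: ring_hom_of_int[OF ring_hom_mconst])
  ultimately show "homogeneous ?w 1 (det (coord_matrix \<sigma> mvar) :: ('n \<times> 'v, 'k) mpoly)"
    unfolding det_def by (metis (no_types, lifting) homogeneous_sum homogeneous_mconst_mult[OF w])
qed

lemma mpoly_eval_det_coord_matrix:
  "mpoly_eval (det (coord_matrix \<sigma> mvar)) x = det (coord_matrix \<sigma> x)"
proof -
  have "(\<chi> i k. msubst (\<lambda>x. x) x (coord_matrix \<sigma> mvar $ i $ k)) = coord_matrix \<sigma> x"
    unfolding coord_matrix_def
    by (auto simp: vec_eq_iff msubst_mvar ring_hom_id ring_homD[OF ring_hom_msubst[OF ring_hom_id]])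
  then show ?thesis
    by (simp add: mpoly_eval_conv_msubst ring_hom_det[OF ring_hom_msubst[OF ring_hom_id]])
qed

text \<open>The open set is the nonvanishing locus of the determinant; at representatives where it
  is nonzero, \<open>coord_matrix\<close> itself is the invertible matrix.\<close>

lemma for_general_points_independent:
  fixes \<sigma> :: "'n::finite \<Rightarrow> 'v::finite" and \<Phi> :: "('n \<Rightarrow> ('v, 'k::field) proj_point) \<Rightarrow> bool"
  assumes "inj \<sigma>"
    and \<Phi>: "\<And>P (A :: 'k ^ 'v ^ 'v). invertible A \<Longrightarrow> (\<And>j. has_coords (P j) (($) (A $ \<sigma> j))) \<Longrightarrow> \<Phi> P"
  shows "for_general_points \<Phi>"
  unfolding for_general_points_def
proof (intro exI conjI ballI)
  let ?g = "det (coord_matrix \<sigma> mvar) :: ('n \<times> 'v, 'k) mpoly"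
  let ?U = "{P. \<not> multi_vanishes_at ?g P}"
  show "zariski_open ?U"
    unfolding zariski_open_def zariski_closed_def
    using is_multiform_det_coord_matrix[OF assms(1)] by (intro exI[of _ "{?g}"]) auto
  \<comment> \<open>Unit vectors at the positions \<open>\<sigma> j\<close> are completed to the
    identity matrix, so they witness nonemptiness.\<close>
  define e :: "'n \<Rightarrow> 'v \<Rightarrow> 'k" where "e = (\<lambda>j i. if \<sigma> j = i then 1 else 0)"
  have "has_coords (abs_proj_point (e j)) (e j)" for j
  proof -
    have "proportional (e j) (e j)"
      unfolding proportional_def e_def by (auto intro: exI[of _ 1])
    then show ?thesis by (simp add: has_coords.abs_eq eq_onp_def)
  qed
  moreover have "coord_matrix \<sigma> (\<lambda>(j, i). e j i) = mat 1"
    using assms(1) by (auto simp: coord_matrix_def mat_def e_def vec_eq_iff)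
  ultimately have "(\<lambda>j. abs_proj_point (e j)) \<in> ?U"
    unfolding multi_vanishes_at_def mpoly_eval_det_coord_matrix
    by (auto intro!: exI[of _ e])
  then show "?U \<noteq> {}" by blast
  fix P assume "P \<in> ?U"
  then obtain x where x: "\<And>j. has_coords (P j) (x j)"
    "det (coord_matrix \<sigma> (\<lambda>(j, i). x j i)) \<noteq> 0"
    by (auto simp: multi_vanishes_at_def mpoly_eval_det_coord_matrix)
  show "\<Phi> P"
  proof (rule \<Phi>)
    show "invertible (coord_matrix \<sigma> (\<lambda>(j, i). x j i))"
      using x(2) by (simp add: invertible_det_nz)
    show "has_coords (P j) (($) (coord_matrix \<sigma> (\<lambda>(j, i). x j i) $ \<sigma> j))" for j
    proof -
      have "($) (coord_matrix \<sigma> (\<lambda>(j, i). x j i) $ \<sigma> j) = x j"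
        using assms(1) by (auto simp: coord_matrix_def)
      then show ?thesis using x(1) by simp
    qed
  qed
qed

section \<open>Both containments for general points\<close>

theorem theorem7p3:
  fixes d n :: nat
  assumes "d \<ge> 1"
    and "CARD('v::finite) = d + 1"
    and "CARD('n::finite) = n"
    and "n \<le> d + 1"
  shows "for_general_points (\<lambda>P :: 'n \<Rightarrow> ('v, 'k::{alg_closed_field, field_char_0}) proj_point.
    \<forall>r\<ge>1.
      symbolic_power (range P) (r * d) \<subseteq>
        ideal_mult (ideal_pow irrelevant_ideal (r * (d - 1)))
                   (ideal_pow (radical_ideal (range P)) r) \<and>
      symbolic_power (range P) (r * d - (d - 1)) \<subseteq>
        ideal_mult (ideal_pow irrelevant_ideal ((r - 1) * (d - 1)))
                   (ideal_pow (radical_ideal (range P)) r))"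
proof -
  \<comment> \<open>Each point gets its own coordinate, which is possible because n <= d +
    1.\<close>
  obtain \<sigma> :: "'n \<Rightarrow> 'v" where \<sigma>: "inj \<sigma>"
    using card_le_inj[of "UNIV :: 'n set" "UNIV :: 'v set"] assms by auto
  \<comment> \<open>Index types are nonempty, so there are p + 1 points with p <= d, the form used
    by the degree inequalities.\<close>
  obtain p where p: "CARD('n) = Suc p"
    using zero_less_card_finite[where 'a = 'n] gr0_implies_Suc by blast
  then have pd: "p \<le> d" and card: "card (range \<sigma>) = Suc p"
    using assms card_image[OF \<sigma>] by auto
  have degrees: "Suc p * m \<le> p * sum a UNIV + sum a (- range \<sigma>)" "m \<le> sum a UNIV"
    "sum a (- range \<sigma>) \<le> sum a UNIV"
    if "\<And>j. m \<le> sum a (- {\<sigma> j})" for a :: "'v \<Rightarrow> nat" and m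
  proof -
    show "Suc p * m \<le> p * sum a UNIV + sum a (- range \<sigma>)"
      using that by (intro sum_Compl_singletons card) auto
    have mono: "sum a S \<le> sum a UNIV" for S by (rule sum_mono2) auto
    show "sum a (- range \<sigma>) \<le> sum a UNIV" by (rule mono)
    show "m \<le> sum a UNIV" using that mono order.trans by blast
  qed
  show ?thesis
  proof (rule for_general_points_independent[OF \<sigma>], intro allI impI conjI)
    fix P and A :: "'k ^ 'v ^ 'v" and r :: nat
    assume A: "invertible A" "\<And>j. has_coords (P j) (($) (A $ \<sigma> j))" and "1 \<le> r"
    show "symbolic_power (range P) (r * d) \<subseteq>
        ideal_mult (ideal_pow irrelevant_ideal (r * (d - 1))) (ideal_pow (radical_ideal (range P)) r)"
    proof (rule symbolic_power_subset_independent[OF A])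
      fix a :: "'v \<Rightarrow> nat" assume "\<And>j. r * d \<le> sum a (- {\<sigma> j})"
      note deg = degrees[OF this]
      show "r \<le> r * d \<and> r * (d - 1) + r \<le> sum a UNIV \<and>
          r * (d - 1) + 2 * r \<le> sum a UNIV + sum a (- range \<sigma>)"
        using degree_bound_a[OF deg \<open>d \<ge> 1\<close> pd] \<open>d \<ge> 1\<close> by simp
    qed
    \<comment> \<open>For r = s + 1 the exponent becomes sd + 1, so the truncated subtraction is
      exact.\<close>
    obtain s where s: "r = Suc s" using \<open>1 \<le> r\<close> by (cases r) auto
    then have m: "r * d - (d - 1) = s * d + 1" using \<open>d \<ge> 1\<close> by simp
    show "symbolic_power (range P) (r * d - (d - 1)) \<subseteq>
        ideal_mult (ideal_pow irrelevant_ideal ((r - 1) * (d - 1))) (ideal_pow (radical_ideal (range P)) r)"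
      unfolding m
    proof (rule symbolic_power_subset_independent[OF A])
      fix a :: "'v \<Rightarrow> nat" assume "\<And>j. s * d + 1 \<le> sum a (- {\<sigma> j})"
      note deg = degrees[OF this]
      show "r \<le> s * d + 1 \<and> (r - 1) * (d - 1) + r \<le> sum a UNIV \<and>
          (r - 1) * (d - 1) + 2 * r \<le> sum a UNIV + sum a (- range \<sigma>)"
        using degree_bound_b[OF deg \<open>d \<ge> 1\<close> pd] \<open>d \<ge> 1\<close> by (simp add: s)
    qed
  qed
qed

end
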